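(* Let $G$ be a connected graph, set $\rho=\rho(G)$, and let $p_\rho(x)$ be the minimal polynomial of $\rho$ over $\mathbb Q$. Then $\operatorname{ord}_{p_\rho}\phi_G=1$. Moreover, $$\kappa_{\mathrm m}(G)=1\iff M_G(x)\text{ is irreducible over }\mathbb Q.$$
   Context: All graphs are finite, simple and undirected. For a graph $G$, $A(G)$ is its adjacency matrix, $\phi_G(x)=\det(xI-A(G))$, and $\rho(G)$ is the spectral radius of $A(G)$ (the Perron root, i.e. the largest adjacency eigenvalue). An adjacency eigenvalue is main if its eigenspace is not orthogonal to the all-one vector; the main polynomial $M_G(x)$ is the product of $(x-\lambda)$ over the distinct main eigenvalues $\lambda$ of $G$ (it divides $\phi_G$ in $\mathbb Z[x]$). If $\phi_G=\prod_{i=1}^r f_i^{m_i}$ with $f_i$ distinct, monic and irreducible over $\mathbb Q$, the main-factor multiplicity is $\kappa_{\mathrm m}(G):=\sum_{i:\,f_i\mid M_G} m_i$. $\operatorname{ord}_f\phi$ denotes the multiplicity of the irreducible polynomial $f$ in $\phi$ over $\mathbb Q$. *)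

theory Defs
  imports
    "HOL-Computational_Algebra.Field_as_Ring"
    "Graph_Theory.Graph_Theory"
    "Jordan_Normal_Form.Spectral_Radius"
begin

text \<open>
  Finite simple undirected graphs are the locale predicate \<^term>\<open>graph\<close>: finite loopfree
  symmetric digraphs without multiple arcs, each edge being a pair of opposite arcs.
  A matrix needs an ordering of the vertices; it is given as a list \<open>vs\<close> enumerating
  \<^term>\<open>verts G\<close> without repetition.  The entry type is left polymorphic so that the same
  0/1 matrix can be read over the rational, real and complex numbers.
\<close>

definition adj_mat :: "('a, 'b) pre_digraph \<Rightarrow> 'a list \<Rightarrow> 'c :: comm_ring_1 mat" where
  "adj_mat G vs = mat (length vs) (length vs)
     (\<lambda>(i, j). if vs ! i \<rightarrow>\<^bsub>G\<^esub> vs ! j then 1 else 0)"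

definition graph_char_poly :: "('a, 'b) pre_digraph \<Rightarrow> 'a list \<Rightarrow> rat poly" where
  "graph_char_poly G vs = char_poly (adj_mat G vs)"

text \<open>
  \<^term>\<open>spectral_radius\<close> is the largest absolute value of a complex eigenvalue; for the
  nonnegative matrix here it is itself the largest (real) eigenvalue.
\<close>

definition graph_spectral_radius :: "('a, 'b) pre_digraph \<Rightarrow> 'a list \<Rightarrow> real" where
  "graph_spectral_radius G vs = spectral_radius (adj_mat G vs)"

abbreviation real_poly_of_rat :: "rat poly \<Rightarrow> real poly" where
  "real_poly_of_rat \<equiv> map_poly of_rat"

text \<open>
  Adjacency matrices are real symmetric, so their eigenvalues are real and nothing is lost by
  considering main eigenvalues over the reals only.
\<close>

definition main_eigenvalue :: "real mat \<Rightarrow> real \<Rightarrow> bool" where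
  "main_eigenvalue A k \<longleftrightarrow>
     (\<exists>v. eigenvector A v k \<and> v \<bullet> vec (dim_row A) (\<lambda>_. 1) \<noteq> 0)"

definition main_poly :: "('a, 'b) pre_digraph \<Rightarrow> 'a list \<Rightarrow> real poly" where
  "main_poly G vs = (\<Prod>k | main_eigenvalue (adj_mat G vs) k. [:- k, 1:])"

text \<open>
  The main polynomial is a product of real linear factors, so it lives in the type of real
  polynomials; being irreducible over the rationals includes having rational coefficients.
\<close>

definition irreducible_over_rat :: "real poly \<Rightarrow> bool" where
  "irreducible_over_rat p \<longleftrightarrow> (\<exists>q. p = real_poly_of_rat q \<and> irreducible q)"

text \<open>
  The elements of \<^term>\<open>prime_factors\<close> of a rational polynomial are its distinct irreducible
  factors, normalized to be monic.
  The divisibility below is that of real polynomials; for polynomials with rational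
  coefficients it coincides with divisibility over the rationals.
\<close>

definition main_factor_multiplicity :: "('a, 'b) pre_digraph \<Rightarrow> 'a list \<Rightarrow> nat" where
  "main_factor_multiplicity G vs =
     (\<Sum>f | f \<in> prime_factors (graph_char_poly G vs) \<and> real_poly_of_rat f dvd main_poly G vs.
        multiplicity f (graph_char_poly G vs))"

definition is_min_rat_poly :: "real \<Rightarrow> rat poly \<Rightarrow> bool" where
  "is_min_rat_poly x p \<longleftrightarrow>
     monic p \<and> poly (real_poly_of_rat p) x = 0 \<and>
     (\<forall>q. q \<noteq> 0 \<and> poly (real_poly_of_rat q) x = 0 \<longrightarrow> degree p \<le> degree q)"

definition min_rat_poly :: "real \<Rightarrow> rat poly" where
  "min_rat_poly x = (THE p. is_min_rat_poly x p)"

text \<open>The description above determines a polynomial whenever \<open>x\<close> is algebraic.\<close>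

lemma is_min_rat_poly_min_rat_poly:
  assumes "q \<noteq> 0" and "poly (real_poly_of_rat q) x = 0"
  shows "is_min_rat_poly x (min_rat_poly x)"
proof -
  interpret rp: map_poly_inj_idom_hom "of_rat :: rat \<Rightarrow> real" ..
  let ?P = "\<lambda>q. q \<noteq> 0 \<and> poly (real_poly_of_rat q) x = 0"
  define r where "r = arg_min degree ?P"
  have P: "?P q" using assms by simp
  have r: "r \<noteq> 0" "poly (real_poly_of_rat r) x = 0"
    using arg_min_natI[of ?P, OF P, of degree] by (auto simp: r_def)
  have r_le: "degree r \<le> degree s" if "?P s" for s
    using arg_min_nat_le[of ?P, OF that, of degree] by (simp add: r_def)
  define p where "p = Polynomial.smult (inverse (lead_coeff r)) r"
  have p: "is_min_rat_poly x p"
    using r r_le by (auto simp: is_min_rat_poly_def p_def hom_distribs)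
  have "p' = p" if p': "is_min_rat_poly x p'" for p'
  proof (rule ccontr)
    assume "p' \<noteq> p"
    hence nz: "p' - p \<noteq> 0" by simp
    have "p \<noteq> 0" "p' \<noteq> 0"
      using p p' by (auto simp: is_min_rat_poly_def)
    hence deg: "degree p' = degree p"
      using p p' by (intro antisym) (simp_all add: is_min_rat_poly_def)
    have root: "poly (real_poly_of_rat (p' - p)) x = 0"
      using p p' by (simp add: is_min_rat_poly_def hom_distribs)
    have "degree p \<le> degree (p' - p)"
      using p nz root by (simp add: is_min_rat_poly_def)
    moreover have "degree (p' - p) \<le> degree p"
      using deg by (intro degree_diff_le) auto
    ultimately have "degree (p' - p) = degree p" by simp
    hence "lead_coeff (p' - p) = 0"
      using p p' deg by (metis coeff_diff diff_self is_min_rat_poly_def)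
    thus False using nz leading_coeff_0_iff by blast
  qed
  thus ?thesis
    using p unfolding min_rat_poly_def by (metis theI)
qed

end

theory Submission
  imports Defs
begin

text \<open>
  For a real symmetric matrix \<open>A\<close> and a vector \<open>v\<close>, the monic polynomial of least degree that
  annihilates \<open>v\<close> is the product of \<open>X - k\<close> over the eigenvalues \<open>k\<close> having an eigenvector not
  orthogonal to \<open>v\<close>. With \<open>v\<close> the all-one vector \<open>j\<close> this is the main polynomial \<open>M\<close>, which is
  therefore rational, like \<open>A\<close> and \<open>j\<close>. The same fact for arbitrary \<open>v\<close> serves as a spectral theorem
  and yields the Rayleigh inequality, from which connectivity gives a positive eigenvector for
  \<open>\<rho>\<close> and the simplicity of \<open>\<rho>\<close> as a root of \<open>\<phi>\<close>. Hence \<open>p\<^sub>\<rho>\<close> divides \<open>M\<close>, \<open>M\<close> divides \<open>\<phi>\<close>, and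
  \<open>p\<^sub>\<rho>\<^sup>2\<close> does not divide \<open>\<phi>\<close>; so the main-factor multiplicity is 1 iff \<open>M\<close> has no prime factor other
  than \<open>p\<^sub>\<rho>\<close>.
\<close>

section \<open>Polynomials in a matrix acting on a vector\<close>

text \<open>The vector p(A) v, evaluated by Horner's scheme, so that only matrix-vector products
  occur and induction over \<open>pCons\<close> applies.\<close>

definition poly_act :: "'a :: field mat \<Rightarrow> 'a poly \<Rightarrow> 'a vec \<Rightarrow> 'a vec" where
  "poly_act A p v = fold_coeffs (\<lambda>c w. c \<cdot>\<^sub>v v + A *\<^sub>v w) p (0\<^sub>v (dim_row A))"

lemma zero_smult_vec: "v \<in> carrier_vec n \<Longrightarrow> (0 :: 'a :: field) \<cdot>\<^sub>v v = 0\<^sub>v n"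
  by (intro eq_vecI) auto

context
  fixes A :: "'a :: field mat" and n :: nat
  assumes A: "A \<in> carrier_mat n n"
begin

lemma mult_mat_zero_vec [simp]: "A *\<^sub>v 0\<^sub>v n = 0\<^sub>v n"
  using A by (intro eq_vecI) auto

lemma poly_act_0 [simp]: "poly_act A 0 v = 0\<^sub>v n"
  using A by (simp add: poly_act_def)

lemma poly_act_pCons:
  assumes "v \<in> carrier_vec n"
  shows "poly_act A (pCons c p) v = c \<cdot>\<^sub>v v + A *\<^sub>v poly_act A p v"
proof (cases "pCons c p = 0")
  case True
  then show ?thesis using assms by (auto simp: zero_smult_vec)
next
  case False
  then show ?thesis
    by (cases "p = 0") (simp_all add: poly_act_def fold_coeffs_pCons_not_0_0_eq)
qed

lemma poly_act_carrier [simp]: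
  assumes "v \<in> carrier_vec n"
  shows "poly_act A p v \<in> carrier_vec n"
  using assms A by (induction p) (auto simp: poly_act_pCons)

lemma poly_act_dim [simp]: "v \<in> carrier_vec n \<Longrightarrow> dim_vec (poly_act A p v) = n"
  using poly_act_carrier by (rule carrier_vecD)

lemma poly_act_add:
  assumes v: "v \<in> carrier_vec n"
  shows "poly_act A (p + q) v = poly_act A p v + poly_act A q v"
proof (induction p q rule: poly_induct2)
  case (pCons a p b q)
  have "poly_act A (pCons a p + pCons b q) v =
      (a + b) \<cdot>\<^sub>v v + A *\<^sub>v (poly_act A p v + poly_act A q v)"
    using v pCons by (simp add: poly_act_pCons)
  also have "\<dots> = (a \<cdot>\<^sub>v v + b \<cdot>\<^sub>v v) + (A *\<^sub>v poly_act A p v + A *\<^sub>v poly_act A q v)"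
    using v A by (simp add: add_smult_distrib_vec mult_add_distrib_mat_vec[OF A])
  finally show ?case
    using v A by (auto simp: poly_act_pCons intro!: eq_vecI)
qed auto

lemma poly_act_smult:
  assumes v: "v \<in> carrier_vec n"
  shows "poly_act A (Polynomial.smult c p) v = c \<cdot>\<^sub>v poly_act A p v"
proof (induction p)
  case (pCons a p)
  then show ?case
    using v A by (auto simp: poly_act_pCons mult_mat_vec[OF A] smult_add_distrib_vec smult_smult_assoc)
qed auto

lemma poly_act_diff:
  assumes v: "v \<in> carrier_vec n"
  shows "poly_act A (p - q) v = poly_act A p v - poly_act A q v"
proof -
  have "poly_act A (p + Polynomial.smult (- 1) q) v = poly_act A p v - poly_act A q v"
    using v A by (auto simp only: poly_act_add poly_act_smult poly_act_carrier intro!: eq_vecI) auto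
  then show ?thesis by simp
qed

lemma poly_act_mult:
  assumes v: "v \<in> carrier_vec n"
  shows "poly_act A (p * q) v = poly_act A p (poly_act A q v)"
proof (induction p)
  case (pCons a p)
  have "A *\<^sub>v poly_act A p (poly_act A q v) \<in> carrier_vec n" using v A by auto
  then show ?case
    using v pCons by (simp add: poly_act_pCons poly_act_add poly_act_smult zero_smult_vec)
qed simp

lemma poly_act_zero_vec [simp]: "poly_act A p (0\<^sub>v n) = 0\<^sub>v n"
  by (induction p) (auto simp: poly_act_pCons)

lemma poly_act_dvd:
  assumes "v \<in> carrier_vec n" "p dvd q" "poly_act A p v = 0\<^sub>v n"
  shows "poly_act A q v = 0\<^sub>v n"
  using assms by (auto simp: poly_act_mult mult.commute[of p] elim!: dvdE)

lemma poly_act_linear: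
  assumes "v \<in> carrier_vec n"
  shows "poly_act A [:- k, 1:] v = A *\<^sub>v v - k \<cdot>\<^sub>v v"
proof -
  have "poly_act A [:- k, 1:] v = - k \<cdot>\<^sub>v v + A *\<^sub>v v"
    using assms A by (auto simp: poly_act_pCons)
  also have "\<dots> = A *\<^sub>v v - k \<cdot>\<^sub>v v"
    using assms A by (intro eq_vecI) auto
  finally show ?thesis .
qed

lemma poly_act_eigenvector:
  assumes v: "v \<in> carrier_vec n" and k: "A *\<^sub>v v = k \<cdot>\<^sub>v v"
  shows "poly_act A p v = poly p k \<cdot>\<^sub>v v"
proof (induction p)
  case (pCons a p)
  then show ?case
    using v A k by (auto simp: poly_act_pCons mult_mat_vec[OF A] algebra_simps intro!: eq_vecI)
qed (use v in auto)

lemma poly_act_sum_index: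
  assumes v: "v \<in> carrier_vec n" and i: "i < n" and F: "finite F"
  shows "poly_act A (\<Sum>k\<in>F. f k) v $ i = (\<Sum>k\<in>F. poly_act A (f k) v $ i)"
  using F
proof (induction F rule: finite_induct)
  case (insert x F)
  then show ?case using v i insert by (simp add: poly_act_add)
qed (use i in simp)

end

section \<open>Annihilating polynomials of a vector\<close>

lemma exists_annihilating_poly:
  fixes A :: "'a :: field mat"
  assumes A: "A \<in> carrier_mat n n" and v: "v \<in> carrier_vec n"
  shows "\<exists>p. p \<noteq> 0 \<and> poly_act A p v = 0\<^sub>v n"
proof -
  text \<open>The \<open>n + 1\<close> Krylov vectors, padded by a zero row to make the matrix square.\<close>
  define K where "K = mat (Suc n) (Suc n)
    (\<lambda>(i, k). if i < n then poly_act A (monom 1 k) v $ i else 0)"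
  have K: "K \<in> carrier_mat (Suc n) (Suc n)" by (simp add: K_def)
  \<comment> \<open>The zero last row of \<open>K\<close> gives the transpose a kernel vector, so
    \<open>det K = 0\<close> and \<open>K\<close> itself has a kernel vector \<open>c\<close>. Its
    entries become the coefficients of the annihilating polynomial.\<close>
  have "transpose_mat K *\<^sub>v unit_vec (Suc n) n = 0\<^sub>v (Suc n)"
    by (intro eq_vecI) (auto simp: K_def scalar_prod_right_unit)
  moreover have "unit_vec (Suc n) n \<noteq> (0\<^sub>v (Suc n) :: 'a vec)"
    by (metis index_unit_vec(2) index_zero_vec(1) lessI one_neq_zero)
  ultimately have "det (transpose_mat K) = 0"
    using K by (subst det_0_iff_vec_prod_zero[of _ "Suc n"]) (auto intro!: exI[of _ "unit_vec (Suc n) n"])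
  then have "det K = 0" using det_transpose[OF K] by simp
  then obtain c where c: "c \<in> carrier_vec (Suc n)" "c \<noteq> 0\<^sub>v (Suc n)" "K *\<^sub>v c = 0\<^sub>v (Suc n)"
    using det_0_iff_vec_prod_zero[OF K] by auto
  define p where "p = (\<Sum>k\<le>n. monom (c $ k) k)"
  have coeff: "coeff p k = c $ k" if "k \<le> n" for k
    using that by (simp add: p_def coeff_sum if_distrib sum.delta cong: if_cong)
  have "p \<noteq> 0"
  proof
    assume "p = 0"
    then have "c = 0\<^sub>v (Suc n)" using c coeff by (intro eq_vecI) (auto simp: less_Suc_eq_le)
    then show False using c by simp
  qed
  moreover have "poly_act A p v $ i = 0" if i: "i < n" for i
  proof -
    have "poly_act A p v $ i = (\<Sum>k\<le>n. poly_act A (Polynomial.smult (c $ k) (monom 1 k)) v $ i)"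
      unfolding p_def by (subst poly_act_sum_index[OF A v i]) (simp_all add: smult_monom)
    also have "\<dots> = (\<Sum>k\<le>n. c $ k * poly_act A (monom 1 k) v $ i)"
    proof (intro sum.cong refl)
      fix k
      show "poly_act A (Polynomial.smult (c $ k) (monom 1 k)) v $ i = c $ k * poly_act A (monom 1 k) v $ i"
        using i poly_act_dim[OF A v] by (simp add: poly_act_smult[OF A v])
    qed
    also have "\<dots> = (\<Sum>k\<in>{0..<Suc n}. row K i $ k * c $ k)"
      using i by (intro sum.cong) (auto simp: K_def mult.commute)
    also have "\<dots> = (K *\<^sub>v c) $ i"
      using i c(1) K by (simp add: scalar_prod_def)
    finally show ?thesis using c i by simp
  qed
  then have "poly_act A p v = 0\<^sub>v n" using poly_act_carrier[OF A v, of p] by (intro eq_vecI) auto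
  ultimately show ?thesis by blast
qed

text \<open>The annihilators of \<open>v\<close> form an ideal: division by a nonzero one of least
  degree leaves a remainder that annihilates \<open>v\<close> too, hence is zero.\<close>

lemma exists_min_annihilating_poly:
  fixes A :: "'a :: field mat"
  assumes A: "A \<in> carrier_mat n n" and v: "v \<in> carrier_vec n"
  shows "\<exists>m. monic m \<and> (\<forall>q. poly_act A q v = 0\<^sub>v n \<longleftrightarrow> m dvd q)"
proof -
  let ?P = "\<lambda>q. q \<noteq> 0 \<and> poly_act A q v = 0\<^sub>v n"
  obtain p where p: "?P p" using exists_annihilating_poly[OF assms] by blast
  define r where "r = arg_min degree ?P"
  have r: "?P r" unfolding r_def by (rule arg_min_natI) (rule p)
  have r_le: "degree r \<le> degree q" if "?P q" for q
    unfolding r_def using that by (rule arg_min_nat_le)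
  define m where "m = Polynomial.smult (inverse (lead_coeff r)) r"
  have m: "monic m" "degree m = degree r" "poly_act A m v = 0\<^sub>v n"
    using r poly_act_smult[OF A v] by (auto simp: m_def)
  have "m dvd q" if q: "poly_act A q v = 0\<^sub>v n" for q
  proof (rule ccontr)
    assume "\<not> m dvd q"
    then have nz: "q mod m \<noteq> 0" by (simp add: dvd_eq_mod_eq_0)
    have "poly_act A (m * (q div m)) v = 0\<^sub>v n"
      using poly_act_dvd[OF A v _ m(3)] by simp
    then have "poly_act A (q - m * (q div m)) v = 0\<^sub>v n"
      using poly_act_diff[OF A v] q by simp
    then have "poly_act A (q mod m) v = 0\<^sub>v n"
      by (simp add: minus_mult_div_eq_mod)
    then have "degree r \<le> degree (q mod m)" using nz r_le by blast
    moreover have "m \<noteq> 0" using m(1) by auto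
    ultimately show False using degree_mod_less'[of m q] m(2) nz by simp
  qed
  then show ?thesis using m poly_act_dvd[OF A v] by blast
qed

section \<open>Real symmetric matrices\<close>

lemma scalar_prod_self_nonneg: "(v :: real vec) \<bullet> v \<ge> 0"
  by (auto simp: scalar_prod_def intro: sum_nonneg)

lemma scalar_prod_self_eq_0:
  assumes "(v :: real vec) \<in> carrier_vec n" "v \<bullet> v = 0"
  shows "v = 0\<^sub>v n"
proof (intro eq_vecI)
  fix i assume "i < dim_vec (0\<^sub>v n :: real vec)"
  moreover have "\<forall>i\<in>{0..<dim_vec v}. v $ i * v $ i = 0"
    using assms(2) unfolding scalar_prod_def by (subst sum_nonneg_eq_0_iff[symmetric]) auto
  ultimately show "v $ i = 0\<^sub>v n $ i" using assms(1) by auto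
qed (use assms in auto)

text \<open>The quadratic is (X - z)(X - conj z). The remainder c + d X modulo it is real and
  vanishes at the non-real number z, which forces c = d = 0.\<close>

lemma real_poly_complex_root_dvd:
  fixes p :: "real poly"
  assumes z: "poly (map_poly complex_of_real p) z = 0" and im: "Im z \<noteq> 0"
  shows "[:(Re z)\<^sup>2 + (Im z)\<^sup>2, - 2 * Re z, 1:] dvd p"
proof -
  interpret cr: map_poly_inj_idom_hom complex_of_real ..
  define Q where "Q = [:(Re z)\<^sup>2 + (Im z)\<^sup>2, - 2 * Re z, 1:]"
  have "degree (p mod Q) < 2"
    using degree_mod_less'[of Q p] by (cases "p mod Q = 0") (auto simp: Q_def)
  then have "p mod Q = [:coeff (p mod Q) 0, coeff (p mod Q) 1:]"
    by (intro poly_eqI) (auto simp: coeff_pCons coeff_eq_0 split: nat.splits)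
  then obtain c d where cd: "p mod Q = [:c, d:]" by blast
  have "poly (map_poly complex_of_real Q) z = 0"
    by (auto simp: Q_def complex_eq_iff power2_eq_square algebra_simps)
  moreover have "map_poly complex_of_real p =
      map_poly complex_of_real Q * map_poly complex_of_real (p div Q) + map_poly complex_of_real (p mod Q)"
    unfolding cr.hom_mult[symmetric] cr.hom_add[symmetric] by simp
  ultimately have "poly (map_poly complex_of_real (p mod Q)) z = 0" using z by simp
  then have "complex_of_real c + z * complex_of_real d = 0"
    by (simp add: cd of_real_hom.map_poly_pCons_hom)
  then have "c = 0" "d = 0" using im by (auto simp: complex_eq_iff)
  then show ?thesis using cd unfolding Q_def by (simp add: dvd_eq_mod_eq_0)
qed

text \<open>The hypothesis excludes non-real roots (for \<open>b \<noteq> 0\<close>) and multiple roots (for \<open>b = 0\<close>).\<close>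

lemma real_poly_split_distinct:
  fixes p :: "real poly"
  assumes "monic p" and "\<And>a b. \<not> [:a\<^sup>2 + b\<^sup>2, - 2 * a, 1:] dvd p"
  shows "p = (\<Prod>k | poly p k = 0. [:- k, 1:])"
  using assms
proof (induction "degree p" arbitrary: p)
  case 0
  then have "p = 1" using monic_degree_0 by metis
  then show ?case by simp
next
  case (Suc d)
  have "\<not> constant (poly (map_poly complex_of_real p))"
    using Suc.hyps(2) by (simp add: constant_degree)
  then obtain z where z: "poly (map_poly complex_of_real p) z = 0"
    using fundamental_theorem_of_algebra by blast
  then have "Im z = 0" using real_poly_complex_root_dvd Suc.prems(2) by blast
  then have "z = complex_of_real (Re z)" by (simp add: complex_eq_iff)
  then obtain k where "z = complex_of_real k" by blast
  then have "poly p k = 0" using z by (simp add: of_real_hom.poly_map_poly)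
  then have "[:- k, 1:] dvd p" by (simp add: poly_eq_0_iff_dvd)
  then obtain q where q: "p = [:- k, 1:] * q" by (rule dvdE)
  have mq: "monic q" using Suc.prems(1) unfolding q lead_coeff_mult by simp
  then have "q \<noteq> 0" by auto
  then have "degree q = d" using Suc.hyps(2) unfolding q by (subst (asm) degree_mult_eq) auto
  moreover have "\<not> [:a\<^sup>2 + b\<^sup>2, - 2 * a, 1:] dvd q" for a b
    using Suc.prems(2) dvd_mult unfolding q by blast
  ultimately have IH: "q = (\<Prod>k | poly q k = 0. [:- k, 1:])"
    using Suc.hyps(1) mq by blast
  \<comment> \<open>A second root at \<open>k\<close> would make the excluded quadratic with
    \<open>a = k\<close> and \<open>b = 0\<close> divide \<open>p\<close>.\<close>
  have "poly q k \<noteq> 0"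
  proof
    assume "poly q k = 0"
    then have "[:- k, 1:] * [:- k, 1:] dvd p"
      unfolding q by (intro mult_dvd_mono dvd_refl) (simp add: poly_eq_0_iff_dvd)
    moreover have "[:- k, 1:] * [:- k, 1:] = [:k\<^sup>2 + 0\<^sup>2, - 2 * k, 1:]"
      by (simp add: power2_eq_square)
    ultimately show False using Suc.prems(2)[of k 0] by simp
  qed
  moreover have "{l. poly p l = 0} = insert k {l. poly q l = 0}" unfolding q by auto
  ultimately show ?case
    using poly_roots_finite[OF \<open>q \<noteq> 0\<close>] IH q by simp
qed

text \<open>Newton interpolation: a multiple of \<open>N\<close>, which vanishes at the old nodes,
  corrects the value at the new one.\<close>

lemma exists_interpolating_poly:
  fixes f :: "'a :: field \<Rightarrow> 'a"
  assumes "finite S"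
  shows "\<exists>p. \<forall>k\<in>S. poly p k = f k"
  using assms
proof (induction S rule: finite_induct)
  case (insert x S)
  then obtain p where p: "\<forall>k\<in>S. poly p k = f k" by blast
  define N where "N = (\<Prod>k\<in>S. [:- k, 1:])"
  have N: "poly N x \<noteq> 0" "\<forall>k\<in>S. poly N k = 0"
    using insert by (auto simp: N_def poly_prod)
  define p' where "p' = p + Polynomial.smult ((f x - poly p x) / poly N x) N"
  have "\<forall>k\<in>insert x S. poly p' k = f k"
    using N p by (auto simp: p'_def)
  then show ?case by blast
qed auto

lemma prod_linear_dvd_iff:
  fixes q :: "'a :: field poly"
  assumes "finite S"
  shows "(\<Prod>k\<in>S. [:- k, 1:]) dvd q \<longleftrightarrow> (\<forall>k\<in>S. poly q k = 0)"
  using assms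
proof (induction S arbitrary: q rule: finite_induct)
  case (insert x S)
  show ?case
  proof
    assume "(\<Prod>k\<in>insert x S. [:- k, 1:]) dvd q"
    then show "\<forall>k\<in>insert x S. poly q k = 0"
      using insert by (auto simp: poly_prod elim!: dvdE)
  next
    assume *: "\<forall>k\<in>insert x S. poly q k = 0"
    then have "(\<Prod>k\<in>S. [:- k, 1:]) dvd q" using insert by simp
    then obtain r where r: "q = (\<Prod>k\<in>S. [:- k, 1:]) * r" by (rule dvdE)
    have "poly (\<Prod>k\<in>S. [:- k, 1:]) x \<noteq> 0" using insert by (auto simp: poly_prod)
    then have "[:- x, 1:] dvd r" using * r by (auto simp: poly_eq_0_iff_dvd[symmetric])
    then have "(\<Prod>k\<in>S. [:- k, 1:]) * [:- x, 1:] dvd q" unfolding r by (rule mult_dvd_mono[OF dvd_refl])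
    then show "(\<Prod>k\<in>insert x S. [:- k, 1:]) dvd q" using insert by (simp add: mult.commute)
  qed
qed auto

section \<open>Spectral properties of symmetric matrices and the Rayleigh inequality\<close>

locale real_symmetric_mat =
  fixes A :: "real mat" and n :: nat
  assumes A: "A \<in> carrier_mat n n" and symmetric: "transpose_mat A = A"
begin

lemma mult_mat_vec_closed [simp]: "v \<in> carrier_vec n \<Longrightarrow> A *\<^sub>v v \<in> carrier_vec n"
  using A by auto

lemma self_adjoint:
  assumes "u \<in> carrier_vec n" "v \<in> carrier_vec n"
  shows "(A *\<^sub>v u) \<bullet> v = u \<bullet> (A *\<^sub>v v)"
  using transpose_vec_mult_scalar[OF A assms(2,1)] symmetric by simp

lemma poly_act_self_adjoint:
  assumes u: "u \<in> carrier_vec n" and v: "v \<in> carrier_vec n"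
  shows "poly_act A p u \<bullet> v = u \<bullet> poly_act A p v"
  using v
proof (induction p arbitrary: v)
  case (pCons c p)
  \<comment> \<open>Self-adjointness moves the outer \<open>A\<close> onto \<open>v\<close>, which
    is why the induction generalizes over \<open>v\<close>. Commuting \<open>p\<close> with the
    polynomial X brings \<open>A\<close> back outside.\<close>
  have "A *\<^sub>v poly_act A p v = poly_act A p (A *\<^sub>v v)"
  proof -
    have X: "poly_act A [:0, 1:] w = A *\<^sub>v w" if "w \<in> carrier_vec n" for w
      using poly_act_linear[OF A that, of 0] that by (intro eq_vecI) (use A in auto)
    have "A *\<^sub>v poly_act A p v = poly_act A ([:0, 1:] * p) v"
      using X pCons.prems A by (simp only: poly_act_mult[OF A] poly_act_carrier[OF A])
    also have "\<dots> = poly_act A (p * [:0, 1:]) v" by (simp only: mult.commute)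
    also have "\<dots> = poly_act A p (A *\<^sub>v v)"
      using X pCons.prems A by (simp only: poly_act_mult[OF A])
    finally show ?thesis .
  qed
  then have "u \<bullet> (A *\<^sub>v poly_act A p v) = (A *\<^sub>v poly_act A p u) \<bullet> v"
    using self_adjoint[of "poly_act A p u" v] pCons u A by (simp add: poly_act_carrier[OF A])
  moreover have "A *\<^sub>v poly_act A p u \<in> carrier_vec n" "A *\<^sub>v poly_act A p v \<in> carrier_vec n"
    using u pCons.prems A poly_act_carrier[OF A] by simp_all
  ultimately show ?case
    using u pCons.prems
    by (simp add: poly_act_pCons[OF A] add_scalar_prod_distrib[of _ n] scalar_prod_add_distrib[of _ n])
qed (use u A in auto)

text \<open>Self-adjointness moves the polynomial onto \<open>w\<close>, where it acts as the scalar
  \<open>poly p k\<close>.\<close>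

lemma eigenvector_poly_act:
  assumes "v \<in> carrier_vec n" "eigenvector A w k"
  shows "w \<bullet> poly_act A p v = poly p k * (w \<bullet> v)"
proof -
  have w: "w \<in> carrier_vec n" "A *\<^sub>v w = k \<cdot>\<^sub>v w" using assms A by (auto simp: eigenvector_def)
  show ?thesis
    using poly_act_self_adjoint[OF w(1) assms(1)] poly_act_eigenvector[OF A w] w assms by simp
qed

text \<open>Let B = X - a, m = (B^2 + b^2) s and w = s(A) v. Pairing m(A) v = 0 with w gives |B(A)
  w|^2 + b^2 |w|^2 = 0, so B(A) w = 0. Then B s annihilates v although its degree is one below that
  of m.\<close>

lemma min_annihilating_poly_no_quadratic_factor:
  assumes v: "v \<in> carrier_vec n" and m: "monic m" "\<And>q. poly_act A q v = 0\<^sub>v n \<longleftrightarrow> m dvd q"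
  shows "\<not> [:a\<^sup>2 + b\<^sup>2, - 2 * a, 1:] dvd m"
proof
  define B where "B = [:- a, 1:]"
  assume "[:a\<^sup>2 + b\<^sup>2, - 2 * a, 1:] dvd m"
  moreover have "[:a\<^sup>2 + b\<^sup>2, - 2 * a, 1:] = B * B + [:b\<^sup>2:]"
    by (simp add: B_def power2_eq_square)
  ultimately obtain s where s: "m = (B * B + [:b\<^sup>2:]) * s" by (auto elim!: dvdE)
  have "m \<noteq> 0" using m(1) by auto
  then have "s \<noteq> 0" "B * B + [:b\<^sup>2:] \<noteq> 0" using s by auto
  moreover have "degree (B * B + [:b\<^sup>2:]) = 2" by (simp add: B_def)
  ultimately have deg: "degree m = 2 + degree s" unfolding s by (subst degree_mult_eq) simp_all
  define w where "w = poly_act A s v"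
  have w: "w \<in> carrier_vec n" unfolding w_def using A v by (rule poly_act_carrier)
  have Bw: "poly_act A B w \<in> carrier_vec n" using A w by (rule poly_act_carrier)
  have "poly_act A m v = 0\<^sub>v n" using m by simp
  then have "poly_act A (B * B + [:b\<^sup>2:]) w = 0\<^sub>v n"
    unfolding s w_def by (simp only: poly_act_mult[OF A v])
  moreover have "poly_act A (B * B + [:b\<^sup>2:]) w = poly_act A B (poly_act A B w) + b\<^sup>2 \<cdot>\<^sub>v w"
    using A w poly_act_pCons[OF A w, of "b\<^sup>2" 0] poly_act_0[OF A]
    by (simp add: poly_act_add[OF A w] poly_act_mult[OF A w] mult_mat_zero_vec[OF A])
  ultimately have "w \<bullet> (poly_act A B (poly_act A B w) + b\<^sup>2 \<cdot>\<^sub>v w) = 0" using w by simp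
  moreover have "w \<bullet> (poly_act A B (poly_act A B w) + b\<^sup>2 \<cdot>\<^sub>v w) =
      poly_act A B w \<bullet> poly_act A B w + b\<^sup>2 * (w \<bullet> w)"
    using w Bw poly_act_carrier[OF A Bw] poly_act_self_adjoint[OF w Bw]
    by (simp add: scalar_prod_add_distrib[of _ n])
  ultimately have sum0: "poly_act A B w \<bullet> poly_act A B w + b\<^sup>2 * (w \<bullet> w) = 0" by simp
  then have "poly_act A B w \<bullet> poly_act A B w = 0"
    using scalar_prod_self_nonneg[of w] scalar_prod_self_nonneg[of "poly_act A B w"]
    by (smt (verit) mult_nonneg_nonneg zero_le_power2)
  then have "poly_act A B w = 0\<^sub>v n" using Bw by (rule scalar_prod_self_eq_0[rotated])
  then have "poly_act A (B * s) v = 0\<^sub>v n" using poly_act_mult[OF A v] by (simp add: w_def)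
  then have "m dvd B * s" using m by simp
  moreover have "B * s \<noteq> 0" "degree (B * s) = 1 + degree s"
    using \<open>s \<noteq> 0\<close> by (auto simp: B_def degree_mult_eq simp del: mult_pCons_left)
  ultimately show False using dvd_imp_degree_le[of m "B * s"] deg by simp
qed

text \<open>For the all-one vector these are the main eigenvalues; the Rayleigh inequality uses them
  for arbitrary \<open>v\<close>.\<close>

definition support_eigenvalues :: "real vec \<Rightarrow> real set" where
  "support_eigenvalues v = {k. \<exists>w. eigenvector A w k \<and> w \<bullet> v \<noteq> 0}"

text \<open>The minimal annihilating polynomial \<open>m\<close> of \<open>v\<close> has only real
  simple roots, and these are exactly the support eigenvalues. So \<open>m\<close> is the product of
  their linear factors.\<close>

lemma
  assumes v: "v \<in> carrier_vec n"
  shows finite_support_eigenvalues: "finite (support_eigenvalues v)"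
    and poly_act_eq_0_iff: "poly_act A q v = 0\<^sub>v n \<longleftrightarrow> (\<forall>k\<in>support_eigenvalues v. poly q k = 0)"
proof -
  obtain m where m: "monic m" "\<And>q. poly_act A q v = 0\<^sub>v n \<longleftrightarrow> m dvd q"
    using exists_min_annihilating_poly[OF A v] by blast
  then have "m \<noteq> 0" by auto
  have eq: "support_eigenvalues v = {k. poly m k = 0}"
  proof (intro equalityI subsetI CollectI)
    fix k assume "k \<in> support_eigenvalues v"
    then obtain w where w: "eigenvector A w k" "w \<bullet> v \<noteq> 0" by (auto simp: support_eigenvalues_def)
    have "w \<in> carrier_vec n" using w A by (auto simp: eigenvector_def)
    then have "w \<bullet> poly_act A m v = 0" using m(2)[of m] by simp
    then show "poly m k = 0" using eigenvector_poly_act[OF v w(1)] w(2) by simp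
  next
    fix k assume "k \<in> {k. poly m k = 0}"
    then have "[:- k, 1:] dvd m" by (simp add: poly_eq_0_iff_dvd)
    then obtain s where s: "m = [:- k, 1:] * s" by (rule dvdE)
    have "s \<noteq> 0" using s \<open>m \<noteq> 0\<close> by auto
    then have "degree m = 1 + degree s" unfolding s by (subst degree_mult_eq) auto
    then have "\<not> m dvd s" using dvd_imp_degree_le[of m s] \<open>s \<noteq> 0\<close> by auto
    \<comment> \<open>By minimality of \<open>m\<close> the cofactor \<open>s\<close> does not
      annihilate \<open>v\<close>, so \<open>w\<close> is nonzero; X - k annihilates it, making it
      an eigenvector for \<open>k\<close>.\<close>
    define w where "w = poly_act A s v"
    have w: "w \<in> carrier_vec n" unfolding w_def using A v by (rule poly_act_carrier)
    have "w \<noteq> 0\<^sub>v n" using m(2) \<open>\<not> m dvd s\<close> by (simp add: w_def)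
    have "poly_act A m v = 0\<^sub>v n" using m(2) by simp
    then have "poly_act A [:- k, 1:] w = 0\<^sub>v n"
      unfolding s w_def by (simp only: poly_act_mult[OF A v])
    then have Aw0: "A *\<^sub>v w - k \<cdot>\<^sub>v w = 0\<^sub>v n" using poly_act_linear[OF A w] by simp
    have "A *\<^sub>v w = k \<cdot>\<^sub>v w"
    proof (intro eq_vecI)
      fix i assume "i < dim_vec (k \<cdot>\<^sub>v w)"
      then show "(A *\<^sub>v w) $ i = (k \<cdot>\<^sub>v w) $ i"
        using arg_cong[OF Aw0, of "\<lambda>x. x $ i"] w A by auto
    qed (use w A in auto)
    then have ev: "eigenvector A w k"
      using w \<open>w \<noteq> 0\<^sub>v n\<close> A by (auto simp: eigenvector_def)
    \<comment> \<open>Both sides equal the pairing of \<open>w\<close> with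
      \<open>poly_act A s v\<close>; hence \<open>w\<close> is not orthogonal to
      \<open>v\<close>.\<close>
    have "poly s k * (w \<bullet> v) = w \<bullet> w"
      using eigenvector_poly_act[OF v ev, of s] by (simp add: w_def)
    moreover have "w \<bullet> w \<noteq> 0" using scalar_prod_self_eq_0[OF w] \<open>w \<noteq> 0\<^sub>v n\<close> by auto
    ultimately have "w \<bullet> v \<noteq> 0" by auto
    then show "k \<in> support_eigenvalues v" using ev by (auto simp: support_eigenvalues_def)
  qed
  show fin: "finite (support_eigenvalues v)" unfolding eq by (rule poly_roots_finite[OF \<open>m \<noteq> 0\<close>])
  have "m = (\<Prod>k\<in>support_eigenvalues v. [:- k, 1:])"
    unfolding eq using m(1) min_annihilating_poly_no_quadratic_factor[OF v m] by (rule real_poly_split_distinct)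
  then show "poly_act A q v = 0\<^sub>v n \<longleftrightarrow> (\<forall>k\<in>support_eigenvalues v. poly q k = 0)"
    using m(2)[of q] prod_linear_dvd_iff[OF fin, of q] by simp
qed

text \<open>A polynomial \<open>s\<close> with \<open>s(k)\<^sup>2 = r - k\<close> on the relevant eigenvalues turns
  \<open>r \<cdot> (u \<bullet> u) - u \<bullet> A u\<close> into the square norm of \<open>s(A) u\<close>.\<close>

lemma
  assumes r: "\<And>k. eigenvalue A k \<Longrightarrow> k \<le> r" and u: "u \<in> carrier_vec n"
  shows rayleigh_le: "u \<bullet> (A *\<^sub>v u) \<le> r * (u \<bullet> u)"
    and rayleigh_eq: "u \<bullet> (A *\<^sub>v u) = r * (u \<bullet> u) \<Longrightarrow> A *\<^sub>v u = r \<cdot>\<^sub>v u"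
proof -
  obtain s where s: "\<forall>k\<in>support_eigenvalues u. poly s k = sqrt (r - k)"
    using exists_interpolating_poly[OF finite_support_eigenvalues[OF u], of "\<lambda>k. sqrt (r - k)"] by blast
  define y where "y = poly_act A s u"
  have y: "y \<in> carrier_vec n" unfolding y_def using A u by (rule poly_act_carrier)
  have Au: "A *\<^sub>v u \<in> carrier_vec n" using u by simp
  have "poly ([:- r, 1:] + s * s) k = 0" if "k \<in> support_eigenvalues u" for k
  proof -
    have "k \<le> r" using that r by (auto simp: support_eigenvalues_def eigenvalue_def)
    then show ?thesis using s that by simp
  qed
  then have "poly_act A ([:- r, 1:] + s * s) u = 0\<^sub>v n" using poly_act_eq_0_iff[OF u] by blast
  then have sum0: "(A *\<^sub>v u - r \<cdot>\<^sub>v u) + poly_act A s y = 0\<^sub>v n"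
    unfolding y_def by (simp only: poly_act_add[OF A u] poly_act_mult[OF A u] poly_act_linear[OF A u])
  have "u \<bullet> ((A *\<^sub>v u - r \<cdot>\<^sub>v u) + poly_act A s y) = 0" unfolding sum0 using u by simp
  moreover have "u \<bullet> ((A *\<^sub>v u - r \<cdot>\<^sub>v u) + poly_act A s y) = u \<bullet> (A *\<^sub>v u) - r * (u \<bullet> u) + y \<bullet> y"
    using u Au poly_act_carrier[OF A y] poly_act_self_adjoint[OF u y]
    by (simp add: scalar_prod_add_distrib[of _ n] scalar_prod_minus_distrib[of _ n] y_def)
  ultimately have *: "r * (u \<bullet> u) - u \<bullet> (A *\<^sub>v u) = y \<bullet> y" by simp
  then show "u \<bullet> (A *\<^sub>v u) \<le> r * (u \<bullet> u)" using scalar_prod_self_nonneg[of y] by simp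
  assume "u \<bullet> (A *\<^sub>v u) = r * (u \<bullet> u)"
  \<comment> \<open>In the equality case \<open>y\<close> has norm zero, and only the first summand
    of \<open>sum0\<close> remains.\<close>
  then have "y = 0\<^sub>v n" using * y by (intro scalar_prod_self_eq_0) auto
  then have "poly_act A s y = 0\<^sub>v n" using poly_act_zero_vec[OF A] by simp
  then have diff0: "A *\<^sub>v u - r \<cdot>\<^sub>v u = 0\<^sub>v n" using sum0 u Au by simp
  show "A *\<^sub>v u = r \<cdot>\<^sub>v u"
  proof (intro eq_vecI)
    fix i assume "i < dim_vec (r \<cdot>\<^sub>v u)"
    then show "(A *\<^sub>v u) $ i = (r \<cdot>\<^sub>v u) $ i"
      using arg_cong[OF diff0, of "\<lambda>x. x $ i"] u A by auto
  qed (use u A in auto)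
qed

end

section \<open>Perron eigenvalues of symmetric matrices\<close>

lemma mult_mat_vec_index_sum:
  assumes "A \<in> carrier_mat m n" "u \<in> carrier_vec n" "i < m"
  shows "(A *\<^sub>v u) $ i = (\<Sum>j = 0..<n. A $$ (i, j) * u $ j)"
  using assms by (simp add: scalar_prod_def)

lemma sum_const_poly: "(\<Sum>j\<in>S. [:f j:]) = [:\<Sum>j\<in>S. f j:]"
  by (induction S rule: infinite_finite_induct) auto

text \<open>Irreducibility is phrased by closed index sets because it will be applied to the zero
  set of a nonnegative eigenvector.\<close>

locale nonneg_irreducible_symmetric_mat = real_symmetric_mat +
  assumes nonneg: "\<And>i j. i < n \<Longrightarrow> j < n \<Longrightarrow> A $$ (i, j) \<ge> 0"
    and irreducible: "\<And>Z. Z \<subseteq> {..<n} \<Longrightarrow> Z \<noteq> {} \<Longrightarrow>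
      (\<And>i j. i \<in> Z \<Longrightarrow> j < n \<Longrightarrow> A $$ (i, j) \<noteq> 0 \<Longrightarrow> j \<in> Z) \<Longrightarrow> Z = {..<n}"
    and n_pos: "n > 0"
begin

text \<open>A priori only the largest modulus of a complex eigenvalue;
  \<open>exists_perron_vector\<close> shows that it is an eigenvalue of \<open>A\<close>.\<close>

abbreviation \<rho> :: real where
  "\<rho> \<equiv> spectral_radius (map_mat complex_of_real A)"

lemma eigenvalue_le_spectral_radius:
  assumes "eigenvalue A k"
  shows "k \<le> \<rho>"
proof -
  have "complex_of_real k \<in> spectrum (map_mat complex_of_real A)"
    using of_real_hom.eigenvalue_hom[OF A assms] by (simp add: spectrum_def)
  then have "norm (complex_of_real k) \<in> norm ` spectrum (map_mat complex_of_real A)"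
    by (rule imageI)
  then have "norm (complex_of_real k) \<le> \<rho>"
    using A by (intro spectral_radius_mem_max(2)[OF _ n_pos]) auto
  then show ?thesis by simp
qed

text \<open>The zero set of a nonnegative eigenvector is closed under adjacency.\<close>

lemma perron_vector:
  assumes t: "t \<in> carrier_vec n" "t \<noteq> 0\<^sub>v n" "\<And>i. i < n \<Longrightarrow> t $ i \<ge> 0"
    and ge: "\<rho> * (t \<bullet> t) \<le> t \<bullet> (A *\<^sub>v t)"
  shows "A *\<^sub>v t = \<rho> \<cdot>\<^sub>v t" and "\<And>i. i < n \<Longrightarrow> t $ i > 0"
proof -
  show eig: "A *\<^sub>v t = \<rho> \<cdot>\<^sub>v t"
    using rayleigh_le[OF eigenvalue_le_spectral_radius t(1)] ge
    by (intro rayleigh_eq[OF eigenvalue_le_spectral_radius t(1)]) auto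
  define Z where "Z = {i. i < n \<and> t $ i = 0}"
  have closed: "j \<in> Z" if i: "i \<in> Z" and j: "j < n" and nz: "A $$ (i, j) \<noteq> 0" for i j
  proof -
    \<comment> \<open>Row \<open>i\<close> of the eigenvalue equation, where
      \<open>t $ i = 0\<close>: a vanishing sum of nonnegative terms.\<close>
    have "(\<Sum>j = 0..<n. A $$ (i, j) * t $ j) = 0"
      using arg_cong[OF eig, of "\<lambda>x. x $ i"] mult_mat_vec_index_sum[OF A t(1), of i] i t by (auto simp: Z_def)
    moreover have "\<And>j. j \<in> {0..<n} \<Longrightarrow> A $$ (i, j) * t $ j \<ge> 0"
      using i nonneg t(3) by (auto simp: Z_def)
    ultimately have "A $$ (i, j) * t $ j = 0"
      using j by (subst (asm) sum_nonneg_eq_0_iff) auto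
    then show ?thesis using nz j by (auto simp: Z_def)
  qed
  have "Z = {}"
  proof (rule ccontr)
    assume "Z \<noteq> {}"
    then have "Z = {..<n}" using closed by (intro irreducible) (auto simp: Z_def)
    then have "t = 0\<^sub>v n" using t(1) by (intro eq_vecI) (auto simp: Z_def set_eq_iff)
    then show False using t(2) by simp
  qed
  then show "t $ i > 0" if "i < n" for i using t(3)[OF that] that by (force simp: Z_def)
qed

text \<open>Let \<open>t\<close> consist of the moduli of a complex eigenvector whose eigenvalue has
  modulus \<rho>. The triangle inequality gives \<rho> t \<le> A t entrywise, and pairing with
  \<open>t\<close> gives the hypothesis of \<open>perron_vector\<close>.\<close>

lemma exists_perron_vector:
  "\<exists>t \<in> carrier_vec n. A *\<^sub>v t = \<rho> \<cdot>\<^sub>v t \<and> (\<forall>i<n. t $ i > 0)"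
proof -
  let ?C = "map_mat complex_of_real A"
  have C: "?C \<in> carrier_mat n n" using A by simp
  obtain l where l: "eigenvalue ?C l" "norm l = \<rho>"
    using spectral_radius_mem_max(1)[OF C n_pos] by (auto simp: spectrum_def)
  then obtain z where "eigenvector ?C z l" by (auto simp: eigenvalue_def)
  then have z: "z \<in> carrier_vec n" "z \<noteq> 0\<^sub>v n" "?C *\<^sub>v z = l \<cdot>\<^sub>v z"
    using C by (auto simp: eigenvector_def)
  define t where "t = vec n (\<lambda>i. norm (z $ i))"
  have t: "t \<in> carrier_vec n" by (simp add: t_def)
  have "t \<noteq> 0\<^sub>v n"
  proof
    assume t0: "t = 0\<^sub>v n"
    have "z = 0\<^sub>v n"
    proof (intro eq_vecI)
      fix i assume "i < dim_vec (0\<^sub>v n :: complex vec)"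
      then show "z $ i = 0\<^sub>v n $ i" using arg_cong[OF t0, of "\<lambda>x. x $ i"] by (simp add: t_def)
    qed (use z in auto)
    then show False using z by simp
  qed
  moreover have ge: "\<rho> * t $ i \<le> (A *\<^sub>v t) $ i" if i: "i < n" for i
  proof -
    have "l * z $ i = (?C *\<^sub>v z) $ i" using z i by simp
    also have "\<dots> = (\<Sum>j = 0..<n. of_real (A $$ (i, j)) * z $ j)"
      using z(1) A i by (auto simp: scalar_prod_def intro!: sum.cong)
    finally have "\<rho> * t $ i = norm (\<Sum>j = 0..<n. of_real (A $$ (i, j)) * z $ j)"
      using i l(2) by (metis norm_mult index_vec t_def)
    also have "\<dots> \<le> (\<Sum>j = 0..<n. norm (of_real (A $$ (i, j)) * z $ j))" by (rule norm_sum)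
    also have "\<dots> = (\<Sum>j = 0..<n. A $$ (i, j) * t $ j)"
      using i nonneg by (intro sum.cong) (auto simp: t_def norm_mult)
    finally show ?thesis using mult_mat_vec_index_sum[OF A t i] by simp
  qed
  moreover have "\<rho> * (t \<bullet> t) \<le> t \<bullet> (A *\<^sub>v t)"
  proof -
    have "\<rho> * (t \<bullet> t) = (\<Sum>i = 0..<n. t $ i * (\<rho> * t $ i))"
      using t by (simp add: scalar_prod_def sum_distrib_left algebra_simps)
    also have "\<dots> \<le> (\<Sum>i = 0..<n. t $ i * (A *\<^sub>v t) $ i)"
      using ge by (intro sum_mono mult_left_mono) (auto simp: t_def)
    also have "\<dots> = t \<bullet> (A *\<^sub>v t)" using A by (simp add: scalar_prod_def)
    finally show ?thesis .
  qed
  moreover have "\<And>i. i < n \<Longrightarrow> t $ i \<ge> 0" by (simp add: t_def)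
  ultimately show ?thesis using perron_vector[OF t] t by blast
qed

text \<open>Replacing the entries of \<open>u\<close> by their absolute values keeps the norm and
  does not decrease the quadratic form, so \<open>perron_vector\<close> applies to the
  result.\<close>

lemma perron_eigenvector_nowhere_zero:
  assumes u: "u \<in> carrier_vec n" "u \<noteq> 0\<^sub>v n" "A *\<^sub>v u = \<rho> \<cdot>\<^sub>v u" and i: "i < n"
  shows "u $ i \<noteq> 0"
proof -
  define t where "t = vec n (\<lambda>i. \<bar>u $ i\<bar>)"
  have t: "t \<in> carrier_vec n" by (simp add: t_def)
  have "t \<noteq> 0\<^sub>v n"
  proof
    assume t0: "t = 0\<^sub>v n"
    have "u = 0\<^sub>v n"
    proof (intro eq_vecI)
      fix i assume "i < dim_vec (0\<^sub>v n :: real vec)"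
      then show "u $ i = 0\<^sub>v n $ i" using arg_cong[OF t0, of "\<lambda>x. x $ i"] by (simp add: t_def)
    qed (use u in auto)
    then show False using u by simp
  qed
  moreover have "\<rho> * (t \<bullet> t) \<le> t \<bullet> (A *\<^sub>v t)"
  proof -
    have "\<rho> * (t \<bullet> t) = \<rho> * (u \<bullet> u)"
      using u(1) by (simp add: scalar_prod_def t_def)
    also have "\<dots> = u \<bullet> (A *\<^sub>v u)" using u by simp
    also have "\<dots> = (\<Sum>i = 0..<n. u $ i * (\<Sum>j = 0..<n. A $$ (i, j) * u $ j))"
      using A u(1) by (simp add: scalar_prod_def)
    also have "\<dots> \<le> (\<Sum>i = 0..<n. t $ i * (\<Sum>j = 0..<n. A $$ (i, j) * t $ j))"
    proof (intro sum_mono)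
      fix i assume i: "i \<in> {0..<n}"
      have "u $ i * (\<Sum>j = 0..<n. A $$ (i, j) * u $ j) \<le> \<bar>u $ i\<bar> * \<bar>\<Sum>j = 0..<n. A $$ (i, j) * u $ j\<bar>"
        by (metis abs_ge_self abs_mult)
      also have "\<dots> \<le> \<bar>u $ i\<bar> * (\<Sum>j = 0..<n. \<bar>A $$ (i, j) * u $ j\<bar>)"
        by (intro mult_left_mono sum_abs) auto
      also have "\<dots> = t $ i * (\<Sum>j = 0..<n. A $$ (i, j) * t $ j)"
        using i nonneg by (auto simp: t_def abs_mult)
      finally show "u $ i * (\<Sum>j = 0..<n. A $$ (i, j) * u $ j) \<le> t $ i * (\<Sum>j = 0..<n. A $$ (i, j) * t $ j)" .
    qed
    also have "\<dots> = t \<bullet> (A *\<^sub>v t)" using A t by (simp add: scalar_prod_def)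
    finally show ?thesis .
  qed
  ultimately have "t $ i > 0" using t i by (intro perron_vector(2)[OF t]) (auto simp: t_def)
  then show ?thesis using i by (simp add: t_def)
qed

text \<open>The eigenspace of \<rho> is a line: the combination \<open>d\<close> of \<open>t\<close>
  and \<open>u\<close> vanishes at index 0, so it is zero, and pairing it with \<open>t\<close>
  contradicts orthogonality.\<close>

lemma perron_eigenvector_orthogonal_zero:
  assumes u: "u \<in> carrier_vec n" "A *\<^sub>v u = \<rho> \<cdot>\<^sub>v u"
    and t: "t \<in> carrier_vec n" "A *\<^sub>v t = \<rho> \<cdot>\<^sub>v t" "t \<noteq> 0\<^sub>v n" and ortho: "t \<bullet> u = 0"
  shows "u = 0\<^sub>v n"
proof (rule ccontr)
  assume "u \<noteq> 0\<^sub>v n"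
  then have u0: "u $ 0 \<noteq> 0" using perron_eigenvector_nowhere_zero[OF u(1) _ u(2) n_pos] by simp
  define d where "d = u $ 0 \<cdot>\<^sub>v t - t $ 0 \<cdot>\<^sub>v u"
  have d: "d \<in> carrier_vec n" using u t by (simp add: d_def)
  have "A *\<^sub>v d = u $ 0 \<cdot>\<^sub>v (\<rho> \<cdot>\<^sub>v t) - t $ 0 \<cdot>\<^sub>v (\<rho> \<cdot>\<^sub>v u)"
    using u t by (simp add: d_def mult_minus_distrib_mat_vec[OF A] mult_mat_vec[OF A])
  also have "\<dots> = \<rho> \<cdot>\<^sub>v d"
    using u t by (intro eq_vecI) (auto simp: d_def algebra_simps)
  finally have "A *\<^sub>v d = \<rho> \<cdot>\<^sub>v d" .
  moreover have "d $ 0 = 0" using u t n_pos by (simp add: d_def)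
  ultimately have "d = 0\<^sub>v n" using perron_eigenvector_nowhere_zero[OF d _ _ n_pos] by blast
  then have "t \<bullet> d = 0" using t by simp
  then have "u $ 0 * (t \<bullet> t) = 0"
    using u t ortho by (simp add: d_def scalar_prod_minus_distrib[of _ n])
  then show False using u0 scalar_prod_self_eq_0[OF t(1)] t(3) by simp
qed

section \<open>Simplicity of \<rho> as a root of the characteristic polynomial\<close>

abbreviation shifted_mat :: "real mat" where
  "shifted_mat \<equiv> \<rho> \<cdot>\<^sub>m 1\<^sub>m n - A"

lemma shifted_mult_mat_vec:
  assumes "u \<in> carrier_vec n"
  shows "shifted_mat *\<^sub>v u = \<rho> \<cdot>\<^sub>v u - A *\<^sub>v u"
proof -
  have "shifted_mat *\<^sub>v u = (\<rho> \<cdot>\<^sub>m 1\<^sub>m n) *\<^sub>v u - A *\<^sub>v u"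
    using assms A by (intro minus_mult_distrib_mat_vec) auto
  moreover have "(\<rho> \<cdot>\<^sub>m 1\<^sub>m n) *\<^sub>v u = \<rho> \<cdot>\<^sub>v u"
    using assms by (intro eq_vecI) (auto simp: scalar_prod_left_unit row_smult)
  ultimately show ?thesis by simp
qed

text \<open>A kernel vector of the minor, extended by a zero, would be an eigenvector for \<open>\<rho>\<close>
  with a vanishing entry.\<close>

lemma det_shifted_minor_nonzero: "det (mat_delete shifted_mat 0 0) \<noteq> 0"
proof
  assume det0: "det (mat_delete shifted_mat 0 0) = 0"
  obtain n' where n': "n = Suc n'" using n_pos by (cases n) auto
  have M: "shifted_mat \<in> carrier_mat n n" using A by (rule minus_carrier_mat)
  have D: "mat_delete shifted_mat 0 0 \<in> carrier_mat n' n'"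
    using mat_delete_carrier[OF M] n' by simp
  obtain w where w: "w \<in> carrier_vec n'" "w \<noteq> 0\<^sub>v n'" "mat_delete shifted_mat 0 0 *\<^sub>v w = 0\<^sub>v n'"
    using det0 det_0_iff_vec_prod_zero[OF D] by auto
  define u where "u = vCons 0 w"
  have u: "u \<in> carrier_vec n" using w by (simp add: u_def n')
  \<comment> \<open>At index 0 the first factor vanishes by the choice of \<open>u\<close>, at the
    other indices the second one does since \<open>w\<close> is in the kernel of the minor. So
    \<open>u\<close> attains equality in the Rayleigh inequality.\<close>
  have entry: "u $ i * (shifted_mat *\<^sub>v u) $ i = 0" if "i < n" for i
  proof (cases i)
    case (Suc i')
    then have i': "i' < n'" using that n' by simp
    have "(shifted_mat *\<^sub>v u) $ Suc i' = (\<Sum>j = 0..<Suc n'. shifted_mat $$ (Suc i', j) * u $ j)"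
      using mult_mat_vec_index_sum[OF M u] i' n' by simp
    also have "\<dots> = (\<Sum>j = 0..<n'. shifted_mat $$ (Suc i', Suc j) * w $ j)"
      using w by (subst sum.atLeast0_lessThan_Suc_shift) (auto simp: u_def)
    also have "\<dots> = (mat_delete shifted_mat 0 0 *\<^sub>v w) $ i'"
      unfolding mult_mat_vec_index_sum[OF D w(1) i'] using A n' i'
      by (intro sum.cong) (auto simp: mat_delete_def)
    finally show ?thesis using w i' Suc by simp
  qed (simp add: u_def)
  have "u \<bullet> (shifted_mat *\<^sub>v u) = 0"
    using entry M A by (auto simp: scalar_prod_def intro!: sum.neutral)
  then have "u \<bullet> (A *\<^sub>v u) = \<rho> * (u \<bullet> u)"
    using u A by (simp add: shifted_mult_mat_vec scalar_prod_minus_distrib[of _ n])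
  then have "A *\<^sub>v u = \<rho> \<cdot>\<^sub>v u" by (intro rayleigh_eq[OF eigenvalue_le_spectral_radius u])
  moreover have "u \<noteq> 0\<^sub>v n"
  proof
    assume u0: "u = 0\<^sub>v n"
    have "w = 0\<^sub>v n'"
    proof (intro eq_vecI)
      fix i assume "i < dim_vec (0\<^sub>v n' :: real vec)"
      then show "w $ i = 0\<^sub>v n' $ i"
        using arg_cong[OF u0, of "\<lambda>x. x $ Suc i"] w by (simp add: u_def n')
    qed (use w in auto)
    then show False using w by simp
  qed
  ultimately have "u $ 0 \<noteq> 0" using perron_eigenvector_nowhere_zero[OF u _ _ n_pos] by blast
  then show False by (simp add: u_def)
qed

lemma char_poly_root_spectral_radius: "poly (char_poly A) \<rho> = 0"
proof -
  obtain t where t: "t \<in> carrier_vec n" "A *\<^sub>v t = \<rho> \<cdot>\<^sub>v t" "\<forall>i<n. t $ i > 0"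
    using exists_perron_vector by blast
  have "t \<noteq> 0\<^sub>v n" using t n_pos by auto
  then have "eigenvalue A \<rho>" using t A by (auto simp: eigenvalue_def eigenvector_def)
  then show ?thesis using eigenvalue_root_char_poly[OF A] by simp
qed

text \<open>Pairing the Perron vector \<open>t\<close> with the first column \<open>c\<close> of the adjugate of \<open>X I - A\<close> gives
  \<open>(X - \<rho>) \<cdot> (t \<bullet> c) = \<phi> \<cdot> t\<^sub>0\<close>. At a double root \<open>\<rho>\<close>, the vector \<open>c(\<rho>)\<close> would thus be an
  eigenvector orthogonal to \<open>t\<close>, hence zero, although its first entry is a nonzero minor.\<close>

lemma spectral_radius_simple_root: "\<not> [:- \<rho>, 1:]\<^sup>2 dvd char_poly A"
proof
  assume "[:- \<rho>, 1:]\<^sup>2 dvd char_poly A"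
  then obtain \<psi> where \<psi>: "char_poly A = [:- \<rho>, 1:]\<^sup>2 * \<psi>" by (rule dvdE)
  obtain t where t: "t \<in> carrier_vec n" "A *\<^sub>v t = \<rho> \<cdot>\<^sub>v t" "\<forall>i<n. t $ i > 0"
    using exists_perron_vector by blast
  have t0: "t \<noteq> 0\<^sub>v n" using t n_pos by auto
  define B where "B = char_poly_matrix A"
  have B: "B \<in> carrier_mat n n" using A by (simp add: B_def)
  \<comment> \<open>The qualified \<open>Determinant.adj_mat\<close> is the adjugate, as opposed to
    the adjacency matrix \<open>adj_mat\<close>.\<close>
  have adj: "Determinant.adj_mat B \<in> carrier_mat n n" using adj_mat(1)[OF B] .
  have evalB: "map_mat (\<lambda>p. poly p \<rho>) B = shifted_mat"
    using A by (intro eq_matI) (auto simp: B_def char_poly_matrix_def)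
  have A_sym: "A $$ (j, i) = A $$ (i, j)" if "i < n" "j < n" for i j
    using arg_cong[OF symmetric, of "\<lambda>M. M $$ (i, j)"] that A by simp
  have B_sym: "transpose_mat B = B"
    using A A_sym by (intro eq_matI) (auto simp: B_def char_poly_matrix_def)
  define c where "c = col (Determinant.adj_mat B) 0"
  have c: "c \<in> carrier_vec n" using adj by (auto simp: c_def)
  have Bc: "B *\<^sub>v c = char_poly A \<cdot>\<^sub>v unit_vec n 0"
  proof -
    have "B *\<^sub>v c = col (B * Determinant.adj_mat B) 0"
      unfolding c_def using col_mult2[OF B adj n_pos] by simp
    also have "\<dots> = char_poly A \<cdot>\<^sub>v unit_vec n 0"
      using adj_mat(2)[OF B] n_pos by (intro eq_vecI) (auto simp: char_poly_def B_def unit_vec_def)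
    finally show ?thesis .
  qed
  define T where "T = map_vec (\<lambda>a. [:a:]) t"
  have T: "T \<in> carrier_vec n" using t by (simp add: T_def)
  have BT: "B *\<^sub>v T = [:- \<rho>, 1:] \<cdot>\<^sub>v T"
  proof (intro eq_vecI)
    fix i assume "i < dim_vec ([:- \<rho>, 1:] \<cdot>\<^sub>v T)"
    then have i: "i < n" using T by simp
    have "(B *\<^sub>v T) $ i = (\<Sum>j = 0..<n. (if i = j then [:0, 1:] * [:t $ j:] else 0) - [:A $$ (i, j) * t $ j:])"
      using B T i A t by (auto simp: scalar_prod_def B_def char_poly_matrix_def T_def intro!: sum.cong)
    also have "\<dots> = [:0, 1:] * [:t $ i:] - (\<Sum>j = 0..<n. [:A $$ (i, j) * t $ j:])"
      using i by (simp add: sum_subtractf)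
    also have "(\<Sum>j = 0..<n. [:A $$ (i, j) * t $ j:]) = [:(A *\<^sub>v t) $ i:]"
      using mult_mat_vec_index_sum[OF A t(1) i] by (simp add: sum_const_poly)
    finally show "(B *\<^sub>v T) $ i = ([:- \<rho>, 1:] \<cdot>\<^sub>v T) $ i"
      using t i by (simp add: T_def)
  qed (use B T in auto)
  have "[:- \<rho>, 1:] * (T \<bullet> c) = (transpose_mat B *\<^sub>v T) \<bullet> c"
    using T c by (simp add: B_sym BT)
  also have "\<dots> = T \<bullet> (B *\<^sub>v c)" by (rule transpose_vec_mult_scalar[OF B c T])
  also have "\<dots> = char_poly A * [:t $ 0:]"
    using T t n_pos by (simp add: Bc T_def)
  also have "\<dots> = [:- \<rho>, 1:] * ([:- \<rho>, 1:] * \<psi> * [:t $ 0:])"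
    by (simp only: \<psi> power2_eq_square mult.assoc)
  \<comment> \<open>One factor X - \<rho> cancels; the other makes the pairing vanish at
    \<rho>.\<close>
  finally have "T \<bullet> c = [:- \<rho>, 1:] * \<psi> * [:t $ 0:]"
    by (subst (asm) mult_cancel_left) simp
  then have "poly (T \<bullet> c) \<rho> = 0" by simp
  define a where "a = map_vec (\<lambda>p. poly p \<rho>) c"
  have a: "a \<in> carrier_vec n" using c by (simp add: a_def)
  have "poly (T \<bullet> c) \<rho> = t \<bullet> a"
    using c t by (auto simp: scalar_prod_def a_def T_def poly_sum intro!: sum.cong)
  then have ta: "t \<bullet> a = 0" using \<open>poly (T \<bullet> c) \<rho> = 0\<close> by simp
  \<comment> \<open>Evaluating \<open>Bc\<close> at the root \<rho> of the characteristic polynomial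
    puts \<open>a\<close> into the kernel of \<open>shifted_mat\<close>.\<close>
  have "shifted_mat *\<^sub>v a = map_vec (\<lambda>p. poly p \<rho>) (B *\<^sub>v c)"
    unfolding evalB[symmetric] a_def using semiring_hom.mult_mat_vec_hom[OF poly_hom.semiring_hom_axioms B c] by simp
  also have "\<dots> = 0\<^sub>v n"
    using char_poly_root_spectral_radius by (intro eq_vecI) (auto simp: Bc)
  finally have "\<rho> \<cdot>\<^sub>v a - A *\<^sub>v a = 0\<^sub>v n" using shifted_mult_mat_vec[OF a] by simp
  then have diff0: "(\<rho> \<cdot>\<^sub>v a - A *\<^sub>v a) $ i = 0" if "i < n" for i using that by simp
  have "A *\<^sub>v a = \<rho> \<cdot>\<^sub>v a"
    by (intro eq_vecI) (use diff0 a A in \<open>force+\<close>)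
  then have "a = 0\<^sub>v n" using perron_eigenvector_orthogonal_zero[OF a _ t(1,2) t0 ta] by simp
  then have "a $ 0 = 0" using n_pos by simp
  then have "poly (c $ 0) \<rho> = 0" using c n_pos by (simp add: a_def)
  moreover have "c $ 0 = det (mat_delete B 0 0)"
    using adj B n_pos by (simp add: c_def Determinant.adj_mat_def cofactor_def)
  moreover have "poly (det (mat_delete B 0 0)) \<rho> = det (mat_delete shifted_mat 0 0)"
  proof -
    have "map_mat (\<lambda>p. poly p \<rho>) (mat_delete B 0 0) = mat_delete shifted_mat 0 0"
      unfolding evalB[symmetric] by (intro eq_matI) (auto simp: mat_delete_def)
    then show ?thesis using comm_ring_hom.hom_det[OF poly_hom.comm_ring_hom_axioms, of \<rho> "mat_delete B 0 0"] by simp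
  qed
  ultimately show False using det_shifted_minor_nonzero by simp
qed

end

section \<open>Rationality and factor multiplicities\<close>

text \<open>Extend 1 to a basis of the reals over the rationals. The resulting functional fixes
  every rational number.\<close>

lemma exists_rat_linear_functional:
  "\<exists>L :: real \<Rightarrow> rat. (\<forall>x y. L (x + y) = L x + L y) \<and>
     (\<forall>q x. L (of_rat q * x) = q * L x) \<and> L 1 = 1"
proof -
  let ?s1 = "\<lambda>(q :: rat) (x :: real). of_rat q * x" and ?s2 = "\<lambda>(q :: rat) (x :: rat). q * x"
  interpret R: vector_space ?s1
    by unfold_locales (auto simp: algebra_simps of_rat_add of_rat_mult)
  interpret Q: vector_space ?s2
    by unfold_locales (auto simp: algebra_simps)
  interpret P: vector_space_pair ?s1 ?s2 ..
  have "R.independent {1}" by simp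
  then obtain L where L: "Vector_Spaces.linear ?s1 ?s2 L" "L 1 = 1"
    using P.linear_independent_extend[of "{1}" "\<lambda>_. 1"] by auto
  interpret L: Vector_Spaces.linear ?s1 ?s2 L by (rule L)
  show ?thesis using L.add L.scale L(2) by blast
qed

lemma poly_act_map_rat:
  fixes A :: "rat mat"
  assumes A: "A \<in> carrier_mat n n" and v: "v \<in> carrier_vec n"
  shows "poly_act (map_mat of_rat A) (map_poly of_rat p) (map_vec of_rat v :: real vec) =
    map_vec of_rat (poly_act A p v)"
proof (induction p)
  case 0
  then show ?case using poly_act_0[OF A] A by (auto simp: poly_act_def)
next
  case (pCons c p)
  have B: "map_mat of_rat A \<in> carrier_mat n n" and w: "map_vec of_rat v \<in> carrier_vec n"
    using A v by simp_all
  have "poly_act (map_mat of_rat A) (map_poly of_rat (pCons c p)) (map_vec of_rat v :: real vec) =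
      of_rat c \<cdot>\<^sub>v map_vec of_rat v + map_mat of_rat A *\<^sub>v map_vec of_rat (poly_act A p v)"
    by (simp add: of_rat_hom.map_poly_pCons_hom poly_act_pCons[OF B w] pCons.IH)
  also have "\<dots> = of_rat c \<cdot>\<^sub>v map_vec of_rat v + map_vec of_rat (A *\<^sub>v poly_act A p v)"
    by (simp only: of_rat_hom.mult_mat_vec_hom[OF A poly_act_carrier[OF A v]])
  also have "\<dots> = map_vec of_rat (poly_act A (pCons c p) v)"
    unfolding poly_act_pCons[OF A v] using A v
    by (intro eq_vecI) (auto simp: of_rat_add of_rat_mult simp del: index_mult_mat_vec)
  finally show ?case .
qed

text \<open>Applying a \<open>\<rat>\<close>-linear functional to the coefficients of a real annihilating polynomial of a
  rational vector yields a rational annihilating polynomial of the same degree.\<close>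

lemma (in real_symmetric_mat) support_poly_rational:
  assumes AQ: "A = map_mat of_rat A'" and vQ: "v = map_vec of_rat v'" and v: "v \<in> carrier_vec n"
  shows "\<exists>q :: rat poly. (\<Prod>k\<in>support_eigenvalues v. [:- k, 1:]) = map_poly of_rat q"
proof -
  interpret rp: map_poly_inj_idom_hom "of_rat :: rat \<Rightarrow> real" ..
  define P where "P = (\<Prod>k\<in>support_eigenvalues v. [:- k, 1:])"
  have A': "A' \<in> carrier_mat n n" using A AQ by auto
  have v': "v' \<in> carrier_vec n" using v vQ by auto
  have fin: "finite (support_eigenvalues v)" using v by (rule finite_support_eigenvalues)
  have annih: "poly_act A r v = 0\<^sub>v n \<longleftrightarrow> P dvd r" for r
    using poly_act_eq_0_iff[OF v] prod_linear_dvd_iff[OF fin] unfolding P_def by blast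
  have monic: "monic P" unfolding P_def by (intro monic_prod) auto
  obtain L :: "real \<Rightarrow> rat" where L: "\<And>x y. L (x + y) = L x + L y"
      "\<And>q x. L (of_rat q * x) = q * L x" "L 1 = 1"
    using exists_rat_linear_functional by blast
  have L0: "L 0 = 0" using L(1)[of 0 0] by simp
  have L_sum: "L (sum f S) = (\<Sum>x\<in>S. L (f x))" if "finite S" for f and S :: "nat set"
    using that by (induction S rule: finite_induct) (auto simp: L0 L)
  define q where "q = map_poly L P"
  \<comment> \<open>The entries of \<open>A\<close> and \<open>v\<close> are rational, so
    \<open>L\<close> commutes with every step of Horner's scheme.\<close>
  have act: "L (poly_act A r v $ i) = poly_act A' (map_poly L r) v' $ i" if "i < n" for r i
    using that
  proof (induction r arbitrary: i)
    case 0
    then show ?case using poly_act_0[OF A] poly_act_0[OF A'] L0 by simp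
  next
    case (pCons c r)
    have car: "poly_act A r v \<in> carrier_vec n" "poly_act A' (map_poly L r) v' \<in> carrier_vec n"
      using poly_act_carrier[OF A v] poly_act_carrier[OF A' v'] by blast+
    have "poly_act A (pCons c r) v $ i =
        of_rat (v' $ i) * c + (\<Sum>j = 0..<n. of_rat (A' $$ (i, j)) * poly_act A r v $ j)"
      unfolding poly_act_pCons[OF A v] using A car v pCons.prems A' v'
      by (auto simp: scalar_prod_def AQ vQ mult.commute)
    also have "L \<dots> = v' $ i * L c + (\<Sum>j = 0..<n. A' $$ (i, j) * L (poly_act A r v $ j))"
      by (simp add: L L_sum)
    also have "\<dots> = L c * v' $ i + (\<Sum>j = 0..<n. A' $$ (i, j) * poly_act A' (map_poly L r) v' $ j)"
      using pCons.IH by (simp add: mult.commute)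
    also have "\<dots> = poly_act A' (map_poly L (pCons c r)) v' $ i"
      unfolding Polynomial.map_poly_pCons[of L, OF L0] poly_act_pCons[OF A' v'] using A' car v' pCons.prems
      by (simp add: scalar_prod_def)
    finally show ?case .
  qed
  have "poly_act A' q v' = 0\<^sub>v n"
  proof (intro eq_vecI)
    fix i assume "i < dim_vec (0\<^sub>v n :: rat vec)"
    then show "poly_act A' q v' $ i = 0\<^sub>v n $ i"
      using act[of i P] annih[of P] L0 unfolding q_def by simp
  qed (use poly_act_dim[OF A' v'] in simp)
  then have "P dvd map_poly of_rat q"
    using annih poly_act_map_rat[OF A' v', of q] AQ vQ of_rat_hom.vec_hom_zero by metis
  then obtain r where r: "map_poly of_rat q = P * r" by (rule dvdE)
  \<comment> \<open>Since \<open>L 1 = 1\<close>, the leading coefficient 1 of \<open>P\<close>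
    survives. So \<open>q\<close> is monic of the same degree as its divisor \<open>P\<close>, and
    the two agree.\<close>
  have "coeff q (degree P) = 1" using monic by (simp add: q_def coeff_map_poly L0 L)
  moreover have "degree q \<le> degree P" unfolding q_def by (rule degree_map_poly_le)
  ultimately have q: "degree q = degree P" "lead_coeff q = 1"
    by (metis le_antisym le_degree one_neq_zero)+
  have "r \<noteq> 0" "P \<noteq> 0" using r q by auto
  then have "degree r = 0" using arg_cong[OF r, of degree] q by (simp add: degree_mult_eq)
  moreover have "lead_coeff r = 1"
    using arg_cong[OF r, of lead_coeff] q monic by (simp add: lead_coeff_mult)
  ultimately have "r = 1" by (metis monic_degree_0)
  then have "P = map_poly of_rat q" using r by simp
  then show ?thesis unfolding P_def by blast
qed

text \<open>The factor \<open>p\<close> already contributes 1, and any other prime factor of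
  \<open>m\<close> would add at least 1. So the sum is 1 iff \<open>p\<close> is the only prime
  factor of \<open>m\<close>; as its square does not divide \<open>m\<close>, this means that
  \<open>m\<close> is \<open>p\<close> times a unit.\<close>

lemma main_factor_multiplicity_eq_1_iff:
  fixes \<phi> m p :: "rat poly"
  assumes "\<phi> \<noteq> 0" "monic m" "m dvd \<phi>"
    and p: "irreducible p" "monic p" "p dvd m" "\<not> p\<^sup>2 dvd \<phi>"
  shows "multiplicity p \<phi> = 1"
    and "(\<Sum>f | f \<in> prime_factors \<phi> \<and> f dvd m. multiplicity f \<phi>) = 1 \<longleftrightarrow> irreducible m"
proof -
  have norm: "normalize f = f" if "monic f" for f :: "rat poly"
    using that by (rule normalize_monic)
  have "prime p" using p norm by (auto simp: prime_def irreducible_imp_prime_elem)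
  have "m \<noteq> 0" using assms by auto
  have "p dvd \<phi>" using p assms dvd_trans by blast
  then have pS: "p \<in> prime_factors \<phi>" using \<open>prime p\<close> assms by (simp add: in_prime_factors_iff)
  show mult: "multiplicity p \<phi> = 1"
    using \<open>p dvd \<phi>\<close> p by (intro multiplicity_eqI) (auto simp: power2_eq_square numeral_2_eq_2)
  let ?S = "{f. f \<in> prime_factors \<phi> \<and> f dvd m}"
  have fin: "finite ?S" by simp
  have p_mem: "p \<in> ?S" using pS p by simp
  show "(\<Sum>f\<in>?S. multiplicity f \<phi>) = 1 \<longleftrightarrow> irreducible m"
  proof
    assume "irreducible m"
    have "?S = {p}"
    proof (intro equalityI subsetI)
      fix f assume "f \<in> ?S"
      then have f: "prime f" "f dvd m" by (auto simp: in_prime_factors_iff)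
      have "m dvd f" using \<open>irreducible m\<close> f irreducibleD' not_prime_unit by blast
      then have "p dvd f" using p dvd_trans by blast
      then show "f \<in> {p}" using f \<open>prime p\<close> primes_dvd_imp_eq by blast
    qed (use p_mem in auto)
    then show "(\<Sum>f\<in>?S. multiplicity f \<phi>) = 1" using mult by simp
  next
    assume sum1: "(\<Sum>f\<in>?S. multiplicity f \<phi>) = 1"
    have only_p: "f = p" if f: "f \<in> ?S" for f
    proof (rule ccontr)
      assume "f \<noteq> p"
      have "f dvd \<phi>" "prime f" using f by (auto simp: in_prime_factors_iff)
      then have "multiplicity f \<phi> > 0"
        using assms(1) by (simp add: prime_multiplicity_gt_zero_iff)
      moreover have "(\<Sum>f\<in>{f, p}. multiplicity f \<phi>) \<le> (\<Sum>f\<in>?S. multiplicity f \<phi>)"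
        using fin f p_mem by (intro sum_mono2) auto
      ultimately show False using sum1 mult \<open>f \<noteq> p\<close> by simp
    qed
    obtain r where r: "m = p * r" using p by (elim dvdE)
    have "is_unit r"
    proof (rule ccontr)
      assume "\<not> is_unit r"
      moreover have "r \<noteq> 0" using r \<open>m \<noteq> 0\<close> by auto
      ultimately obtain f where f: "prime f" "f dvd r" using prime_divisor_exists by blast
      then have "f dvd m" using r by simp
      then have "f \<in> ?S" using f assms dvd_trans by (auto simp: in_prime_factors_iff)
      then have "f = p" by (rule only_p)
      then have "p\<^sup>2 dvd m" using f r by (simp add: power2_eq_square)
      then show False using p assms dvd_trans by blast
    qed
    then show "irreducible m" using p(1) r by (simp add: irreducible_mult_unit_right)
  qed
qed

text \<open>Least degree and division with remainder give the divisibility. If p = a b, one factor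
  has the root x and is thus a multiple of p, so the other is a unit.\<close>

lemma min_rat_poly_properties:
  assumes q: "q \<noteq> 0" "poly (real_poly_of_rat q) x = 0"
  shows "monic (min_rat_poly x)" "irreducible (min_rat_poly x)"
    "poly (real_poly_of_rat (min_rat_poly x)) x = 0"
    "\<And>r. poly (real_poly_of_rat r) x = 0 \<Longrightarrow> min_rat_poly x dvd r"
proof -
  interpret rp: map_poly_inj_idom_hom "of_rat :: rat \<Rightarrow> real" ..
  define p where "p = min_rat_poly x"
  have p: "monic p" "poly (real_poly_of_rat p) x = 0"
    "\<And>r. r \<noteq> 0 \<Longrightarrow> poly (real_poly_of_rat r) x = 0 \<Longrightarrow> degree p \<le> degree r"
    using is_min_rat_poly_min_rat_poly[OF q] by (auto simp: is_min_rat_poly_def p_def)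
  show "monic (min_rat_poly x)" "poly (real_poly_of_rat (min_rat_poly x)) x = 0"
    using p by (auto simp: p_def)
  have "p \<noteq> 0" using p by auto
  have dvd: "p dvd r" if r: "poly (real_poly_of_rat r) x = 0" for r
  proof (rule ccontr)
    assume "\<not> p dvd r"
    then have nz: "r mod p \<noteq> 0" by (simp add: dvd_eq_mod_eq_0)
    have "r mod p = r - p * (r div p)" by (simp add: minus_mult_div_eq_mod)
    then have "poly (real_poly_of_rat (r mod p)) x = 0"
      using r p by (simp add: hom_distribs)
    then have "degree p \<le> degree (r mod p)" using nz p by blast
    then show False using degree_mod_less'[of p r] \<open>p \<noteq> 0\<close> nz by simp
  qed
  then show "\<And>r. poly (real_poly_of_rat r) x = 0 \<Longrightarrow> min_rat_poly x dvd r" by (simp add: p_def)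
  have "irreducible p"
  proof (rule irreducibleI)
    show "\<not> p dvd 1"
    proof
      assume "p dvd 1"
      then have "degree p = 0" by (simp add: is_unit_iff_degree \<open>p \<noteq> 0\<close>)
      then have "p = 1" using p(1) monic_degree_0 by metis
      then show False using p(2) by simp
    qed
    fix a b assume ab: "p = a * b"
    then have "poly (real_poly_of_rat a) x = 0 \<or> poly (real_poly_of_rat b) x = 0"
      using p(2) by (simp add: hom_distribs)
    then have "p dvd a \<or> p dvd b" using dvd by blast
    then show "a dvd 1 \<or> b dvd 1"
      using ab \<open>p \<noteq> 0\<close> by (metis dvd_mult_cancel_left dvd_mult_cancel_right mult.right_neutral mult_1 mult_eq_0_iff)
  qed (use \<open>p \<noteq> 0\<close> in auto)
  then show "irreducible (min_rat_poly x)" by (simp add: p_def)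
qed

section \<open>Adjacency matrices\<close>

lemma map_mat_adj_mat_rat: "map_mat of_rat (adj_mat G vs) = (adj_mat G vs :: real mat)"
  by (intro eq_matI) (auto simp: adj_mat_def)

lemma map_mat_adj_mat_complex: "map_mat complex_of_real (adj_mat G vs) = adj_mat G vs"
  by (intro eq_matI) (auto simp: adj_mat_def)

text \<open>An index set closed under nonzero entries is closed under walks, so connectivity makes
  it everything once it is nonempty.\<close>

lemma nonneg_irreducible_symmetric_adj_mat:
  fixes G :: "('a, 'b) pre_digraph" and vs :: "'a list"
  assumes "graph G" and connected: "Digraph_Component.connected G"
    and "distinct vs" and verts: "set vs = verts G"
  shows "nonneg_irreducible_symmetric_mat (adj_mat G vs) (length vs)"
proof -
  interpret graph G by fact
  let ?A = "adj_mat G vs :: real mat" and ?n = "length vs"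
  have sym: "u \<rightarrow>\<^bsub>G\<^esub> v \<longleftrightarrow> v \<rightarrow>\<^bsub>G\<^esub> u" for u v
    using sym_arcs by (auto simp: Digraph.symmetric_def sym_def)
  \<comment> \<open>\<open>connected\<close> speaks of the symmetrized digraph, whose reachability
    is that of \<open>G\<close> because the arcs are symmetric.\<close>
  have reach: "u \<rightarrow>\<^sup>*\<^bsub>G\<^esub> v" if "u \<in> verts G" "v \<in> verts G" for u v
    using connected that reachable_mk_symmetric_eq[OF sym_arcs]
    by (auto simp: connected_def strongly_connected_def)
  show ?thesis
  proof unfold_locales
    show "?A \<in> carrier_mat ?n ?n" by (simp add: adj_mat_def)
    show "transpose_mat ?A = ?A" using sym by (intro eq_matI) (auto simp: adj_mat_def)
    show "?n > 0" using connected verts by (auto simp: connected_def strongly_connected_def)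
    show "?A $$ (i, j) \<ge> 0" if "i < ?n" "j < ?n" for i j using that by (simp add: adj_mat_def)
  next
    fix Z assume Z: "Z \<subseteq> {..<?n}" "Z \<noteq> {}"
      and closed: "\<And>i j. i \<in> Z \<Longrightarrow> j < ?n \<Longrightarrow> ?A $$ (i, j) \<noteq> 0 \<Longrightarrow> j \<in> Z"
    obtain i where i: "i \<in> Z" using Z by blast
    have "j \<in> Z" if j: "j < ?n" for j
    proof -
      have "vs ! i \<in> verts G" "vs ! j \<in> verts G" using i Z j verts nth_mem by blast+
      then have "vs ! i \<rightarrow>\<^sup>*\<^bsub>G\<^esub> vs ! j" by (rule reach)
      \<comment> \<open>Induction over reachability runs over vertices, not indices; distinctness of
        \<open>vs\<close> recovers the index afterwards.\<close>
      then have "\<exists>k\<in>Z. vs ! k = vs ! j"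
      proof (induction rule: reachable_induct)
        case base
        then show ?case using i by blast
      next
        case (step x y)
        then obtain k where k: "k \<in> Z" "vs ! k = x" by blast
        have "y \<in> set vs" using step adj_in_verts verts by blast
        then obtain l where l: "l < ?n" "vs ! l = y" by (auto simp: in_set_conv_nth)
        have "?A $$ (k, l) \<noteq> 0" using k l step Z by (auto simp: adj_mat_def)
        then show ?case using closed k l by blast
      qed
      then obtain k where "k \<in> Z" "vs ! k = vs ! j" by blast
      moreover have "k < ?n" using \<open>k \<in> Z\<close> Z by auto
      ultimately show "j \<in> Z" using \<open>distinct vs\<close> j by (simp add: nth_eq_iff_index_eq)
    qed
    then show "Z = {..<?n}" using Z by auto
  qed
qed

theorem lemma3p4:
  fixes G :: "('a, 'b) pre_digraph" and vs :: "'a list"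
  assumes "graph G" and "Digraph_Component.connected G"
    and "distinct vs" and "set vs = verts G"
  shows "multiplicity (min_rat_poly (graph_spectral_radius G vs)) (graph_char_poly G vs) = 1 \<and>
         (main_factor_multiplicity G vs = 1 \<longleftrightarrow> irreducible_over_rat (main_poly G vs))"
proof -
  interpret rp: map_poly_inj_idom_hom "of_rat :: rat \<Rightarrow> real" ..
  define A where "A = (adj_mat G vs :: real mat)"
  define n where "n = length vs"
  interpret nonneg_irreducible_symmetric_mat A n
    unfolding A_def n_def using assms by (rule nonneg_irreducible_symmetric_adj_mat)
  define \<phi> where "\<phi> = graph_char_poly G vs"
  define p where "p = min_rat_poly \<rho>"
  define j where "j = vec n (\<lambda>_. 1 :: real)"
  have A': "(adj_mat G vs :: rat mat) \<in> carrier_mat n n" by (simp add: adj_mat_def n_def)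
  have \<rho>: "graph_spectral_radius G vs = \<rho>"
    by (simp add: graph_spectral_radius_def A_def map_mat_adj_mat_complex)
  have \<phi>: "real_poly_of_rat \<phi> = char_poly A"
    unfolding \<phi>_def graph_char_poly_def A_def map_mat_adj_mat_rat[symmetric]
    using A' by (rule of_rat_hom.char_poly_hom[symmetric])
  have "monic \<phi>"
    unfolding \<phi>_def graph_char_poly_def using degree_monic_char_poly[OF A'] by simp
  then have "\<phi> \<noteq> 0" by auto
  have "poly (real_poly_of_rat \<phi>) \<rho> = 0"
    using char_poly_root_spectral_radius by (simp add: \<phi>)
  note p = min_rat_poly_properties[OF \<open>\<phi> \<noteq> 0\<close> this, folded p_def]
  have j: "j \<in> carrier_vec n" by (simp add: j_def)
  have "{k. main_eigenvalue A k} = support_eigenvalues j"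
    using A by (simp add: main_eigenvalue_def support_eigenvalues_def j_def)
  then have main_poly: "main_poly G vs = (\<Prod>k\<in>support_eigenvalues j. [:- k, 1:])"
    unfolding main_poly_def A_def by simp
  have fin: "finite (support_eigenvalues j)" using j by (rule finite_support_eigenvalues)
  have "j = map_vec of_rat (vec n (\<lambda>_. 1))" by (auto simp: j_def)
  then obtain m where m: "main_poly G vs = real_poly_of_rat m"
    using support_poly_rational[OF map_mat_adj_mat_rat[symmetric, of G vs, folded A_def] _ j]
    unfolding main_poly by blast
  have "monic (main_poly G vs)" unfolding main_poly by (intro monic_prod) auto
  then have "monic m" by (simp add: m)
  \<comment> \<open>The linear factors belong to distinct roots of the characteristic
    polynomial.\<close>
  have "main_poly G vs dvd char_poly A"
    unfolding main_poly prod_linear_dvd_iff[OF fin]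
    by (auto simp: support_eigenvalues_def eigenvalue_root_char_poly[OF A, symmetric] eigenvalue_def)
  then have "m dvd \<phi>"
    unfolding m \<phi>[symmetric] by (rule of_rat_hom.dvd_map_poly_hom_imp_dvd)
  \<comment> \<open>A positive eigenvector cannot be orthogonal to the all-one vector, so \<rho> is
    main.\<close>
  have "\<rho> \<in> support_eigenvalues j"
  proof -
    obtain t where t: "t \<in> carrier_vec n" "A *\<^sub>v t = \<rho> \<cdot>\<^sub>v t" "\<forall>i<n. t $ i > 0"
      using exists_perron_vector by blast
    have "t \<noteq> 0\<^sub>v n" using t n_pos by auto
    then have "eigenvector A t \<rho>" using t A by (auto simp: eigenvector_def)
    moreover have "t \<bullet> j > 0"
      using t n_pos by (auto simp: scalar_prod_def j_def intro!: sum_pos)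
    ultimately show ?thesis by (auto simp: support_eigenvalues_def)
  qed
  then have "poly (real_poly_of_rat m) \<rho> = 0"
    unfolding m[symmetric] main_poly using fin by (auto simp: poly_prod)
  then have "p dvd m" by (rule p(4))
  \<comment> \<open>Over the reals, the square of \<open>p\<close> would make \<rho> a double root
    of the characteristic polynomial.\<close>
  have "\<not> p\<^sup>2 dvd \<phi>"
  proof
    assume "p\<^sup>2 dvd \<phi>"
    then have "(real_poly_of_rat p)\<^sup>2 dvd char_poly A"
      unfolding \<phi>[symmetric] rp.hom_power[symmetric] by (rule rp.hom_dvd)
    moreover have "[:- \<rho>, 1:]\<^sup>2 dvd (real_poly_of_rat p)\<^sup>2"
      using p(3) by (intro dvd_power_same) (simp add: poly_eq_0_iff_dvd)
    ultimately show False using spectral_radius_simple_root dvd_trans by blast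
  qed
  note result = main_factor_multiplicity_eq_1_iff[OF \<open>\<phi> \<noteq> 0\<close> \<open>monic m\<close> \<open>m dvd \<phi>\<close> p(2,1) \<open>p dvd m\<close> this]
  \<comment> \<open>Divisibility between rational polynomials is the same over the reals, so the sum
    in the definition ranges over the prime factors dividing \<open>m\<close>.\<close>
  have "real_poly_of_rat f dvd main_poly G vs \<longleftrightarrow> f dvd m" for f
    unfolding m using rp.hom_dvd of_rat_hom.dvd_map_poly_hom_imp_dvd by blast
  then have "main_factor_multiplicity G vs = 1 \<longleftrightarrow> irreducible m"
    using result(2) by (simp add: main_factor_multiplicity_def \<phi>_def)
  moreover have "irreducible_over_rat (main_poly G vs) \<longleftrightarrow> irreducible m"
    unfolding irreducible_over_rat_def m by auto
  ultimately show ?thesis using result(1) by (simp add: \<phi>_def p_def \<rho>)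
qed

end
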